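(* Let $M$ be a smooth manifold and let $\nabla$ be a torsion free complex covariant derivative operator acting on the smooth sections of the complexified tangent bundle $\mathbb{C}T_M$. Define recursively $\Theta_2^\nabla:=2R^\nabla$, $$S_k:=\frac{i}{(k+1)!\,k!}\,\mathrm{Sym}_{2,\ldots,k+1}\Theta_k^\nabla\qquad(k\geqslant2),$$ $$\Theta_k^\nabla:=-2i\,(id_1^\nabla)^{k-3}(\nabla R^\nabla)_2+\sum_{r=3}^{k-1}(r+1)!\sum_{p=2}^{r-1}(id_1^\nabla)^{k-1-r}(p\,S_p\wedge_1S_{r-p+1})\qquad(k\geqslant3).$$ Then $$\mathrm{Circ}\,\mathrm{Sym}_{3,\ldots,k+1}\Theta_k^\nabla=0\qquad\text{for }k=4\text{ and }k=5.$$
   Context: $R^\nabla(\cdot,\cdot)\cdot\equiv R^\nabla(\cdot,\cdot,\cdot)$ is the curvature of $\nabla$; in $\nabla^a\theta$ the derivative directions are the first entries (the leftmost entry is the outermost derivative). Tensors with values in $\mathbb{C}T_M$ are extended complex multilinearly. $\mathrm{Sym}_{r_1,\ldots,r_s}$ is the sum over all permutations of the entries $r_1,\ldots,r_s$ (no normalizing coefficient). $(\mathrm{Circ}\,\theta)(v_1,v_2,v_3,\bullet)=\theta(v_1,v_2,v_3,\bullet)+\theta(v_2,v_3,v_1,\bullet)+\theta(v_3,v_1,v_2,\bullet)$. $\theta_2(v_1,v_2,\bullet):=\theta(v_2,v_1,\bullet)$. $d_1^\nabla A(\xi_1,\xi_2,\mu):=\nabla_{\xi_1}A(\xi_2,\mu)-\nabla_{\xi_2}A(\xi_1,\mu)$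 for $A\in C^\infty(M,T_M^{*,\otimes k}\otimes\mathbb{C}T_M)$, $\mu\in T_M^{\oplus(k-1)}$, $k\ge1$. For $A$ with $k+1$ entries and $B$ with $l+1$ entries, $(A\wedge_1B)(\xi_1,\xi_2,\eta,\mu):=A(\xi_1,B(\xi_2,\eta),\mu)-A(\xi_2,B(\xi_1,\eta),\mu)$ with $\xi_1,\xi_2\in T_M$, $\eta\in T_M^{\oplus l}$, $\mu\in T_M^{\oplus(k-1)}$. Empty sums are $0$. *)

theory Defs
  imports "HOL-Analysis.Analysis" "HOL-Library.Function_Algebras"
begin

text \<open>
  \<open>Euclidean_space n\<close> consists of the \<open>x :: nat \<Rightarrow> real\<close> with \<open>x i = 0\<close> for \<open>i \<ge> n\<close>, so
  \<open>x(i := t)\<close> with \<open>i < n\<close> moves \<open>x\<close> along the \<open>i\<close>-th coordinate axis. The dimension is a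
  natural number here; in particular dimension \<open>0\<close> is allowed.
\<close>

fun Ck_on :: "nat \<Rightarrow> nat \<Rightarrow> (nat \<Rightarrow> real) set \<Rightarrow> ((nat \<Rightarrow> real) \<Rightarrow> 'b::real_normed_vector) \<Rightarrow> bool" where
  "Ck_on 0 n V f \<longleftrightarrow> continuous_map (subtopology (Euclidean_space n) V) euclidean f"
| "Ck_on (Suc k) n V f \<longleftrightarrow>
     continuous_map (subtopology (Euclidean_space n) V) euclidean f \<and>
     (\<forall>i<n. \<exists>g. (\<forall>x\<in>V. ((\<lambda>t. f (x(i := t))) has_vector_derivative g x) (at (x i))) \<and> Ck_on k n V g)"

definition smooth_on :: "nat \<Rightarrow> (nat \<Rightarrow> real) set \<Rightarrow> ((nat \<Rightarrow> real) \<Rightarrow> 'b::real_normed_vector) \<Rightarrow> bool" where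
  "smooth_on n V f \<longleftrightarrow> (\<forall>k. Ck_on k n V f)"

type_synonym 'a atlas = "('a set \<times> ('a \<Rightarrow> nat \<Rightarrow> real)) set"

definition smooth_manifold :: "nat \<Rightarrow> 'a topology \<Rightarrow> 'a atlas \<Rightarrow> bool" where
  "smooth_manifold n M \<A> \<longleftrightarrow>
     Hausdorff_space M \<and> second_countable M \<and>
     (\<Union>(U, \<phi>)\<in>\<A>. U) = topspace M \<and>
     (\<forall>(U, \<phi>)\<in>\<A>. openin M U \<and> openin (Euclidean_space n) (\<phi> ` U) \<and>
        homeomorphic_map (subtopology M U) (subtopology (Euclidean_space n) (\<phi> ` U)) \<phi>) \<and>
     (\<forall>(U, \<phi>)\<in>\<A>. \<forall>(U', \<psi>)\<in>\<A>. \<forall>i<n. smooth_on n (\<phi> ` (U \<inter> U')) (\<lambda>x. \<psi> (inv_into U \<phi> x) i))"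

text \<open>
  Functions on \<open>M\<close> are represented by total functions vanishing outside \<open>topspace M\<close>, tangent
  vectors by functionals vanishing on all non-smooth functions, and vector fields by functions
  vanishing outside \<open>topspace M\<close>. Hence equality of such objects on \<open>M\<close> is HOL equality, and
  \<open>+\<close>, \<open>-\<close>, \<open>0\<close> of functions and fields are the pointwise ones.
\<close>

definition smooth_funs :: "nat \<Rightarrow> 'a topology \<Rightarrow> 'a atlas \<Rightarrow> ('a \<Rightarrow> 'b::real_normed_vector) set" where
  "smooth_funs n M \<A> = {f. (\<forall>p. p \<notin> topspace M \<longrightarrow> f p = 0) \<and>
     (\<forall>(U, \<phi>)\<in>\<A>. smooth_on n (\<phi> ` U) (\<lambda>x. f (inv_into U \<phi> x)))}"

definition tangent_space :: "nat \<Rightarrow> 'a topology \<Rightarrow> 'a atlas \<Rightarrow> 'a \<Rightarrow> (('a \<Rightarrow> real) \<Rightarrow> real) set" where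
  "tangent_space n M \<A> p = {u.
     (\<forall>f. f \<notin> smooth_funs n M \<A> \<longrightarrow> u f = 0) \<and>
     (\<forall>f\<in>smooth_funs n M \<A>. \<forall>g\<in>smooth_funs n M \<A>. u (\<lambda>x. f x + g x) = u f + u g) \<and>
     (\<forall>c. \<forall>f\<in>smooth_funs n M \<A>. u (\<lambda>x. c * f x) = c * u f) \<and>
     (\<forall>f\<in>smooth_funs n M \<A>. \<forall>g\<in>smooth_funs n M \<A>. u (\<lambda>x. f x * g x) = f p * u g + g p * u f)}"

text \<open>
  An element \<open>u + \<i> v\<close> of the complexification of the tangent space is identified with its
  complex linear action \<open>(u + \<i> v) (g + \<i> h) = (u g - v h) + \<i> (u h + v g)\<close> on smooth complex functions.
\<close>

definition ctangent_space ::
  "nat \<Rightarrow> 'a topology \<Rightarrow> 'a atlas \<Rightarrow> 'a \<Rightarrow> (('a \<Rightarrow> complex) \<Rightarrow> complex) set" where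
  "ctangent_space n M \<A> p = {D.
     (\<forall>f. f \<notin> smooth_funs n M \<A> \<longrightarrow> D f = 0) \<and>
     (\<exists>u\<in>tangent_space n M \<A> p. \<exists>v\<in>tangent_space n M \<A> p. \<forall>f\<in>smooth_funs n M \<A>.
        D f = Complex (u (Re \<circ> f) - v (Im \<circ> f)) (u (Im \<circ> f) + v (Re \<circ> f)))}"

type_synonym 'a vfield = "'a \<Rightarrow> ('a \<Rightarrow> complex) \<Rightarrow> complex"

text \<open>Smooth sections of the complexified tangent bundle.\<close>

definition cvector_fields :: "nat \<Rightarrow> 'a topology \<Rightarrow> 'a atlas \<Rightarrow> 'a vfield set" where
  "cvector_fields n M \<A> = {X.
     (\<forall>p\<in>topspace M. X p \<in> ctangent_space n M \<A> p) \<and>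
     (\<forall>p. p \<notin> topspace M \<longrightarrow> X p = 0) \<and>
     (\<forall>f\<in>smooth_funs n M \<A>. (\<lambda>p. X p f) \<in> smooth_funs n M \<A>)}"

definition fmult :: "('a \<Rightarrow> complex) \<Rightarrow> 'a vfield \<Rightarrow> 'a vfield" where
  "fmult g X = (\<lambda>p f. g p * X p f)"

definition lie_bracket :: "'a vfield \<Rightarrow> 'a vfield \<Rightarrow> 'a vfield" where
  "lie_bracket X Y = (\<lambda>p f. X p (\<lambda>q. Y q f) - Y p (\<lambda>q. X q f))"

text \<open>
  \<open>nab X Y\<close> is the covariant derivative of \<open>Y\<close> in direction \<open>X\<close>. The 1-form \<open>nab Y\<close> has values in
  the complexified tangent bundle; it is extended complex linearly, so \<open>X\<close> may be complex.
\<close>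

definition complex_connection ::
  "nat \<Rightarrow> 'a topology \<Rightarrow> 'a atlas \<Rightarrow> ('a vfield \<Rightarrow> 'a vfield \<Rightarrow> 'a vfield) \<Rightarrow> bool" where
  "complex_connection n M \<A> nab \<longleftrightarrow>
     (let \<X> = cvector_fields n M \<A>; C = smooth_funs n M \<A> in
       (\<forall>X\<in>\<X>. \<forall>Y\<in>\<X>. nab X Y \<in> \<X>) \<and>
       (\<forall>X\<in>\<X>. \<forall>X'\<in>\<X>. \<forall>Y\<in>\<X>. nab (X + X') Y = nab X Y + nab X' Y) \<and>
       (\<forall>g\<in>C. \<forall>X\<in>\<X>. \<forall>Y\<in>\<X>. nab (fmult g X) Y = fmult g (nab X Y)) \<and>
       (\<forall>X\<in>\<X>. \<forall>Y\<in>\<X>. \<forall>Y'\<in>\<X>. nab X (Y + Y') = nab X Y + nab X Y') \<and>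
       (\<forall>g\<in>C. \<forall>X\<in>\<X>. \<forall>Y\<in>\<X>. nab X (fmult g Y) = fmult (\<lambda>p. X p g) Y + fmult g (nab X Y)))"

definition torsion_free ::
  "nat \<Rightarrow> 'a topology \<Rightarrow> 'a atlas \<Rightarrow> ('a vfield \<Rightarrow> 'a vfield \<Rightarrow> 'a vfield) \<Rightarrow> bool" where
  "torsion_free n M \<A> nab \<longleftrightarrow>
     (\<forall>X\<in>cvector_fields n M \<A>. \<forall>Y\<in>cvector_fields n M \<A>. nab X Y - nab Y X = lie_bracket X Y)"

text \<open>
  A tensor field with \<open>m\<close> entries and values in the complexified tangent bundle is represented
  by its action on lists of \<open>m\<close> vector fields, as a multilinear map over the smooth complex
  functions; the values on lists of other lengths are irrelevant. Entries are numbered from \<open>1\<close>.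
\<close>

type_synonym 'a tensor = "'a vfield list \<Rightarrow> 'a vfield"

definition tscale :: "complex \<Rightarrow> 'a tensor \<Rightarrow> 'a tensor" where
  "tscale c \<theta> = (\<lambda>vs p f. c * \<theta> vs p f)"

fun curvature :: "('a vfield \<Rightarrow> 'a vfield \<Rightarrow> 'a vfield) \<Rightarrow> 'a tensor" where
  "curvature nab [X, Y, Z] = nab X (nab Y Z) - nab Y (nab X Z) - nab (lie_bracket X Y) Z"
| "curvature nab _ = 0"

fun cov_deriv :: "('a vfield \<Rightarrow> 'a vfield \<Rightarrow> 'a vfield) \<Rightarrow> 'a tensor \<Rightarrow> 'a tensor" where
  "cov_deriv nab \<theta> (X # vs) = nab X (\<theta> vs) - (\<Sum>j<length vs. \<theta> (vs[j := nab X (vs ! j)]))"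
| "cov_deriv nab \<theta> [] = 0"

definition Sym :: "nat set \<Rightarrow> 'a tensor \<Rightarrow> 'a tensor" where
  "Sym I \<theta> = (\<lambda>vs. \<Sum>\<sigma> | \<sigma> permutes I. \<theta> (map (\<lambda>j. vs ! (\<sigma> j - 1)) [1..<length vs + 1]))"

fun Circ :: "'a tensor \<Rightarrow> 'a tensor" where
  "Circ \<theta> (v1 # v2 # v3 # vs) = \<theta> (v1 # v2 # v3 # vs) + \<theta> (v2 # v3 # v1 # vs) + \<theta> (v3 # v1 # v2 # vs)"
| "Circ \<theta> _ = 0"

text \<open>\<open>swap12 \<theta>\<close> is \<open>\<theta>\<^sub>2\<close>.\<close>

fun swap12 :: "'a tensor \<Rightarrow> 'a tensor" where
  "swap12 \<theta> (v1 # v2 # vs) = \<theta> (v2 # v1 # vs)"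
| "swap12 \<theta> _ = 0"

fun d1 :: "('a vfield \<Rightarrow> 'a vfield \<Rightarrow> 'a vfield) \<Rightarrow> 'a tensor \<Rightarrow> 'a tensor" where
  "d1 nab A (\<xi>1 # \<xi>2 # \<mu>) = cov_deriv nab A (\<xi>1 # \<xi>2 # \<mu>) - cov_deriv nab A (\<xi>2 # \<xi>1 # \<mu>)"
| "d1 nab A _ = 0"

text \<open>In \<open>wedge1 l A B\<close> the tensor \<open>B\<close> has \<open>l + 1\<close> entries; \<open>\<eta>\<close> is \<open>take l vs\<close>, \<open>\<mu>\<close> is \<open>drop l vs\<close>.\<close>

fun wedge1 :: "nat \<Rightarrow> 'a tensor \<Rightarrow> 'a tensor \<Rightarrow> 'a tensor" where
  "wedge1 l A B (\<xi>1 # \<xi>2 # vs) =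
     A (\<xi>1 # B (\<xi>2 # take l vs) # drop l vs) - A (\<xi>2 # B (\<xi>1 # take l vs) # drop l vs)"
| "wedge1 l A B _ = 0"

definition id1_pow :: "('a vfield \<Rightarrow> 'a vfield \<Rightarrow> 'a vfield) \<Rightarrow> nat \<Rightarrow> 'a tensor \<Rightarrow> 'a tensor" where
  "id1_pow nab m = (\<lambda>A. tscale \<i> (d1 nab A)) ^^ m"

text \<open>\<open>S_of k (Theta nab k)\<close> is \<open>S\<^sub>k\<close>; \<open>\<Theta>\<^sub>k\<close> and \<open>S\<^sub>k\<close> have \<open>k + 1\<close> entries.\<close>

definition S_of :: "nat \<Rightarrow> 'a tensor \<Rightarrow> 'a tensor" where
  "S_of k \<theta> = tscale (\<i> / (fact (k + 1) * fact k)) (Sym {2..k + 1} \<theta>)"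

function Theta :: "('a vfield \<Rightarrow> 'a vfield \<Rightarrow> 'a vfield) \<Rightarrow> nat \<Rightarrow> 'a tensor" where
  "Theta nab k =
     (if k = 2 then tscale 2 (curvature nab)
      else if k \<ge> 3 then
        tscale (- 2 * \<i>) (id1_pow nab (k - 3) (swap12 (cov_deriv nab (curvature nab)))) +
        (\<Sum>r = 3..k - 1. tscale (fact (r + 1)) (\<Sum>p = 2..r - 1.
           id1_pow nab (k - 1 - r)
             (wedge1 (r - p + 1) (tscale (of_nat p) (S_of p (Theta nab p)))
                (S_of (r - p + 1) (Theta nab (r - p + 1))))))
      else 0)"
  by auto
termination
  by (relation "Wellfounded.measure snd") auto

declare Theta.simps [simp del]

end

theory Submission
  imports Defs
begin

text \<open>
  A projection of the space of all fields onto the vector fields turns \<open>\<nabla>\<close> into a total bilinear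
  product whose commutator satisfies the Jacobi identity. In such an algebra the curvature and its
  covariant derivatives satisfy both Bianchi identities and the Ricci identities.
  With \<open>J = Sym\<^bsub>2,3\<^esub> R\<close> and \<open>K = Sym\<^bsub>2,3,4\<^esub> (\<nabla>R)\<^sub>2\<close> one has \<open>S\<^sub>2 = i/6 J\<close> and \<open>S\<^sub>3 = 1/72 K\<close>, hence
  \<open>3/2 \<Theta>\<^sub>4 = 3 d\<^sub>1(\<nabla>R)\<^sub>2 - 2 J \<and>\<^sub>1 J\<close> and
  \<open>18/i \<Theta>\<^sub>5 = 36 d\<^sub>1d\<^sub>1(\<nabla>R)\<^sub>2 - 24 d\<^sub>1(J \<and>\<^sub>1 J) + 10 J \<and>\<^sub>1 K + 15 K \<and>\<^sub>1 J\<close>.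
  The circular sum of the symmetrization is symmetric in all entries but the first three, so by
  polarization these may be taken equal. It is then an explicit rational combination of instances
  of the Bianchi and Ricci identities.
\<close>

section \<open>Smooth functions and complex vector fields\<close>

lemma Ck_on_partial:
  assumes "Ck_on (Suc k) n W f" "i < n"
  obtains f' where "\<And>x. x \<in> W \<Longrightarrow> ((\<lambda>t. f (x(i := t))) has_vector_derivative f' x) (at (x i))"
    and "Ck_on k n W f'"
  using assms unfolding Ck_on.simps by blast

lemma Ck_on_add:
  "Ck_on k n W f \<Longrightarrow> Ck_on k n W g \<Longrightarrow> Ck_on k n W (\<lambda>x. f x + g x)"
proof (induction k arbitrary: f g)
  case 0
  then show ?case by (simp add: continuous_map_add)
next
  case (Suc k)
  have "\<exists>h. (\<forall>x\<in>W. ((\<lambda>t. f (x(i := t)) + g (x(i := t))) has_vector_derivative h x) (at (x i))) \<and> Ck_on k n W h"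
    if i: "i < n" for i
  proof -
    from Suc.prems(1) i obtain f' where
      "\<And>x. x \<in> W \<Longrightarrow> ((\<lambda>t. f (x(i := t))) has_vector_derivative f' x) (at (x i))" "Ck_on k n W f'"
      by (rule Ck_on_partial) blast
    moreover from Suc.prems(2) i obtain g' where
      "\<And>x. x \<in> W \<Longrightarrow> ((\<lambda>t. g (x(i := t))) has_vector_derivative g' x) (at (x i))" "Ck_on k n W g'"
      by (rule Ck_on_partial) blast
    ultimately show ?thesis
      by (intro exI[of _ "\<lambda>x. f' x + g' x"])
        (auto intro: has_vector_derivative_add Suc.IH simp del: fun_upd_apply)
  qed
  then show ?case using Suc.prems by (simp add: continuous_map_add del: fun_upd_apply)
qed

lemma Ck_on_bounded_linear:
  assumes L: "bounded_linear L"
  shows "Ck_on k n W f \<Longrightarrow> Ck_on k n W (\<lambda>x. L (f x))"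
proof (induction k arbitrary: f)
  case 0
  have "continuous_map euclidean euclidean L"
    using L by (simp add: linear_continuous_on)
  from continuous_map_compose[OF _ this] 0 show ?case by (simp add: o_def)
next
  case (Suc k)
  have "continuous_map euclidean euclidean L"
    using L by (simp add: linear_continuous_on)
  moreover have "continuous_map (subtopology (Euclidean_space n) W) euclidean f"
    using Suc.prems by simp
  ultimately have "continuous_map (subtopology (Euclidean_space n) W) euclidean (\<lambda>x. L (f x))"
    using continuous_map_compose[of _ euclidean f euclidean L] by (simp add: o_def)
  moreover have "\<exists>h. (\<forall>x\<in>W. ((\<lambda>t. L (f (x(i := t)))) has_vector_derivative h x) (at (x i))) \<and> Ck_on k n W h"
    if i: "i < n" for i
  proof -
    from Suc.prems i obtain f' where
      "\<And>x. x \<in> W \<Longrightarrow> ((\<lambda>t. f (x(i := t))) has_vector_derivative f' x) (at (x i))" "Ck_on k n W f'"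
      by (rule Ck_on_partial) blast
    then show ?thesis
      by (intro exI[of _ "\<lambda>x. L (f' x)"])
        (auto intro: bounded_linear.has_vector_derivative[OF L] Suc.IH simp del: fun_upd_apply)
  qed
  ultimately show ?case by (simp del: fun_upd_apply)
qed

lemma Ck_on_const: "Ck_on k n W (\<lambda>x. c)"
proof (induction k arbitrary: c)
  case (Suc k)
  have "\<exists>h. (\<forall>x\<in>W. ((\<lambda>t. c) has_vector_derivative h x) (at (x i))) \<and> Ck_on k n W h" for i
    by (intro exI[of _ "\<lambda>x. 0"]) (simp add: Suc)
  then show ?case by simp
qed simp

text \<open>The derivative in \<open>Ck_on\<close> is taken along a full coordinate line, while
  functions are compared on \<open>W\<close> only; openness of the trace of \<open>W\<close> on that
  line makes the comparison local.\<close>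

lemma open_coordinate_line:
  assumes W: "openin (Euclidean_space n) W" and x: "x \<in> W" and i: "i < n"
  shows "open {t. x(i := t) \<in> W}"
proof -
  have "x \<in> topspace (Euclidean_space n)"
    using W x openin_subset by blast
  then have "continuous_map euclideanreal (Euclidean_space n) (\<lambda>t. x(i := t))"
    using i
    by (auto simp: Euclidean_space_def continuous_map_in_subtopology continuous_map_componentwise_UNIV)
  from openin_continuous_map_preimage[OF this W] show ?thesis by simp
qed

lemma Ck_on_cong:
  assumes W: "openin (Euclidean_space n) W"
  shows "Ck_on k n W f \<Longrightarrow> (\<And>x. x \<in> W \<Longrightarrow> f x = g x) \<Longrightarrow> Ck_on k n W g"
\<comment> \<open>The derivative of \<open>f\<close> serves for \<open>g\<close> unchanged, so its
  regularity carries over and a case split suffices.\<close>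
proof (cases k)
  case 0
  assume "Ck_on k n W f" "\<And>x. x \<in> W \<Longrightarrow> f x = g x"
  then show "Ck_on k n W g" using 0
    by (auto intro: continuous_map_eq)
next
  case (Suc l)
  assume f: "Ck_on k n W f" and eq: "\<And>x. x \<in> W \<Longrightarrow> f x = g x"
  have "continuous_map (subtopology (Euclidean_space n) W) euclidean g"
    using f Suc eq by (auto intro: continuous_map_eq)
  moreover have "\<exists>h. (\<forall>x\<in>W. ((\<lambda>t. g (x(i := t))) has_vector_derivative h x) (at (x i))) \<and> Ck_on l n W h"
    if i: "i < n" for i
  proof -
    from f i obtain f' where f':
      "\<And>x. x \<in> W \<Longrightarrow> ((\<lambda>t. f (x(i := t))) has_vector_derivative f' x) (at (x i))" "Ck_on l n W f'"
      unfolding Suc by (rule Ck_on_partial) blast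
    have "((\<lambda>t. g (x(i := t))) has_vector_derivative f' x) (at (x i))" if x: "x \<in> W" for x
      by (rule has_vector_derivative_transform_within_open[OF f'(1)[OF x] open_coordinate_line[OF W x i]])
        (use x eq in \<open>auto simp del: fun_upd_apply simp: fun_upd_triv\<close>)
    then show ?thesis using f' by blast
  qed
  ultimately show "Ck_on k n W g" using Suc by (simp del: fun_upd_apply)
qed

lemma smooth_funs_iff:
  "f \<in> smooth_funs n M \<A> \<longleftrightarrow> (\<forall>p. p \<notin> topspace M \<longrightarrow> f p = 0) \<and>
    (\<forall>U \<phi> k. (U, \<phi>) \<in> \<A> \<longrightarrow> Ck_on k n (\<phi> ` U) (\<lambda>x. f (inv_into U \<phi> x)))"
  by (auto simp: smooth_funs_def smooth_on_def)

lemma smooth_funs_add: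
  "f \<in> smooth_funs n M \<A> \<Longrightarrow> g \<in> smooth_funs n M \<A> \<Longrightarrow> (\<lambda>p. f p + g p) \<in> smooth_funs n M \<A>"
  unfolding smooth_funs_iff by (simp add: Ck_on_add)

lemma smooth_funs_bounded_linear:
  assumes "bounded_linear L" "f \<in> smooth_funs n M \<A>"
  shows "(\<lambda>p. L (f p)) \<in> smooth_funs n M \<A>"
  using assms(2) unfolding smooth_funs_iff
  by (simp add: Ck_on_bounded_linear[OF assms(1)] linear_simps(3)[OF assms(1)])

text \<open>Smooth functions vanish off \<open>topspace M\<close>, so a constant has to be cut off
  there; in each chart it agrees with the true constant.\<close>

lemma smooth_funs_const:
  assumes "smooth_manifold n M \<A>"
  shows "(\<lambda>p. if p \<in> topspace M then c else 0) \<in> smooth_funs n M \<A>"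
proof -
  have "Ck_on k n (\<phi> ` U) (\<lambda>x. if inv_into U \<phi> x \<in> topspace M then c else 0)"
    if U: "(U, \<phi>) \<in> \<A>" for k U \<phi>
  proof (rule Ck_on_cong[OF _ Ck_on_const[of _ _ _ c]])
    show "openin (Euclidean_space n) (\<phi> ` U)"
      using assms U by (auto simp: smooth_manifold_def)
    have "U \<subseteq> topspace M"
      using assms U by (auto simp: smooth_manifold_def)
    then show "c = (if inv_into U \<phi> x \<in> topspace M then c else 0)" if "x \<in> \<phi> ` U" for x
      using that inv_into_into[of x \<phi> U] by auto
  qed
  then show ?thesis by (simp add: smooth_funs_iff)
qed

section \<open>Real and complex tangent vectors\<close>

lemma tangent_spaceD:
  assumes "u \<in> tangent_space n M \<A> p" "f \<in> smooth_funs n M \<A>"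
  shows "g \<in> smooth_funs n M \<A> \<Longrightarrow> u (\<lambda>x. f x + g x) = u f + u g"
    and "u (\<lambda>x. c * f x) = c * u f"
    and "g \<in> smooth_funs n M \<A> \<Longrightarrow> u (\<lambda>x. f x * g x) = f p * u g + g p * u f"
  using assms by (simp_all add: tangent_space_def)

lemma tangent_space_lincomb:
  assumes "u \<in> tangent_space n M \<A> p" "v \<in> tangent_space n M \<A> p"
  shows "(\<lambda>f. a * u f + b * v f) \<in> tangent_space n M \<A> p"
  using assms unfolding tangent_space_def by (auto simp: algebra_simps)

text \<open>The cut-off unit \<open>?e\<close> is idempotent and equals 1 at \<open>p\<close>, so
  the Leibniz rule gives \<open>u ?e = 2 * u ?e\<close>.\<close>

lemma tangent_space_const:
  assumes M: "smooth_manifold n M \<A>" and p: "p \<in> topspace M" and u: "u \<in> tangent_space n M \<A> p"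
  shows "u (\<lambda>q. if q \<in> topspace M then c else 0) = 0"
proof -
  let ?e = "\<lambda>q. if q \<in> topspace M then 1 else 0 :: real"
  have e: "?e \<in> smooth_funs n M \<A>"
    by (rule smooth_funs_const[OF M])
  have "u (\<lambda>q. ?e q * ?e q) = ?e p * u ?e + ?e p * u ?e"
    by (rule tangent_spaceD(3)[OF u e e])
  moreover have "(\<lambda>q. ?e q * ?e q) = ?e" by auto
  ultimately have "u ?e = 0" using p by simp
  moreover have "u (\<lambda>q. c * ?e q) = c * u ?e"
    by (rule tangent_spaceD(2)[OF u e])
  moreover have "(\<lambda>q. c * ?e q) = (\<lambda>q. if q \<in> topspace M then c else 0)" by auto
  ultimately show ?thesis by simp
qed

lemma Re_Im_smooth_funs:
  assumes "f \<in> smooth_funs n M \<A>"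
  shows "Re \<circ> f \<in> smooth_funs n M \<A>" "Im \<circ> f \<in> smooth_funs n M \<A>"
  using assms smooth_funs_bounded_linear[OF bounded_linear_Re]
    smooth_funs_bounded_linear[OF bounded_linear_Im]
  by (auto simp: o_def)

lemma ctangent_space_add:
  assumes D: "D \<in> ctangent_space n M \<A> p" and f: "f \<in> smooth_funs n M \<A>" and g: "g \<in> smooth_funs n M \<A>"
  shows "D (\<lambda>q. f q + g q) = D f + D g"
proof -
  obtain u v where u: "u \<in> tangent_space n M \<A> p" and v: "v \<in> tangent_space n M \<A> p"
    and D: "\<And>f. f \<in> smooth_funs n M \<A> \<Longrightarrow>
        D f = Complex (u (Re \<circ> f) - v (Im \<circ> f)) (u (Im \<circ> f) + v (Re \<circ> f))"
    using D unfolding ctangent_space_def by blast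
  have *: "Re \<circ> (\<lambda>q. f q + g q) = (\<lambda>q. (Re \<circ> f) q + (Re \<circ> g) q)"
    "Im \<circ> (\<lambda>q. f q + g q) = (\<lambda>q. (Im \<circ> f) q + (Im \<circ> g) q)"
    by auto
  show ?thesis
    using Re_Im_smooth_funs[OF f] Re_Im_smooth_funs[OF g] u v
    by (simp add: D f g smooth_funs_add * tangent_spaceD(1) complex_eq_iff del: o_apply)
qed

lemma ctangent_space_const:
  assumes M: "smooth_manifold n M \<A>" and p: "p \<in> topspace M" and D: "D \<in> ctangent_space n M \<A> p"
  shows "D (\<lambda>q. if q \<in> topspace M then c else 0) = 0"
proof -
  let ?c = "\<lambda>q. if q \<in> topspace M then c else 0"
  have "Re \<circ> ?c = (\<lambda>q. if q \<in> topspace M then Re c else 0)"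
    "Im \<circ> ?c = (\<lambda>q. if q \<in> topspace M then Im c else 0)"
    by auto
  with D smooth_funs_const[OF M, of c] show ?thesis
    unfolding ctangent_space_def by (auto simp: tangent_space_const[OF M p] complex_eq_iff)
qed

lemma ctangent_space_lincomb:
  assumes "D \<in> ctangent_space n M \<A> p" "E \<in> ctangent_space n M \<A> p"
  shows "(\<lambda>f. c * D f + E f) \<in> ctangent_space n M \<A> p"
proof -
  obtain u v u' v' where t: "u \<in> tangent_space n M \<A> p" "v \<in> tangent_space n M \<A> p"
      "u' \<in> tangent_space n M \<A> p" "v' \<in> tangent_space n M \<A> p"
    and D: "\<And>f. f \<in> smooth_funs n M \<A> \<Longrightarrow>
        D f = Complex (u (Re \<circ> f) - v (Im \<circ> f)) (u (Im \<circ> f) + v (Re \<circ> f))"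
    and E: "\<And>f. f \<in> smooth_funs n M \<A> \<Longrightarrow>
        E f = Complex (u' (Re \<circ> f) - v' (Im \<circ> f)) (u' (Im \<circ> f) + v' (Re \<circ> f))"
    using assms unfolding ctangent_space_def by blast
  let ?u = "\<lambda>f. 1 * (Re c * u f + (- Im c) * v f) + 1 * u' f"
  let ?v = "\<lambda>f. 1 * (Re c * v f + Im c * u f) + 1 * v' f"
  have "?u \<in> tangent_space n M \<A> p" "?v \<in> tangent_space n M \<A> p"
    using t by (intro tangent_space_lincomb; blast)+
  moreover have "\<forall>f. f \<notin> smooth_funs n M \<A> \<longrightarrow> c * D f + E f = 0"
    using assms unfolding ctangent_space_def by simp
  moreover have "c * D f + E f = Complex (?u (Re \<circ> f) - ?v (Im \<circ> f)) (?u (Im \<circ> f) + ?v (Re \<circ> f))"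
    if "f \<in> smooth_funs n M \<A>" for f
    using that by (simp add: D E complex_eq_iff algebra_simps)
  ultimately show ?thesis
    unfolding ctangent_space_def by (intro CollectI conjI bexI[of _ ?u] bexI[of _ ?v] ballI) simp_all
qed

section \<open>The complex vector space of fields and its operations\<close>

definition cscale :: "complex \<Rightarrow> 'a vfield \<Rightarrow> 'a vfield" where
  "cscale c X = (\<lambda>p f. c * X p f)"

interpretation vfield: vector_space cscale
  by unfold_locales (auto simp: cscale_def fun_eq_iff algebra_simps)

lemma zero_in_ctangent_space: "0 \<in> ctangent_space n M \<A> p"
proof -
  have "(\<lambda>f. 0) \<in> tangent_space n M \<A> p" by (simp add: tangent_space_def)
  then show ?thesis
    unfolding ctangent_space_def by (auto intro!: bexI[of _ "\<lambda>f. 0"] simp: complex_eq_iff)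
qed

lemma subspace_cvector_fields:
  assumes M: "smooth_manifold n M \<A>"
  shows "vfield.subspace (cvector_fields n M \<A>)"
proof -
  have 0: "0 \<in> cvector_fields n M \<A>"
    using smooth_funs_const[OF M, of "0 :: complex"]
    by (simp add: cvector_fields_def zero_in_ctangent_space)
  have *: "cscale c X + Y \<in> cvector_fields n M \<A>"
    if X: "X \<in> cvector_fields n M \<A>" and Y: "Y \<in> cvector_fields n M \<A>" for c X Y
  proof -
    have "cscale c X + Y = (\<lambda>p f. c * X p f + Y p f)" by (simp add: cscale_def fun_eq_iff)
    moreover have "(\<lambda>p. c * X p f + Y p f) \<in> smooth_funs n M \<A>" if "f \<in> smooth_funs n M \<A>" for f
      using X Y that
      by (auto simp: cvector_fields_def intro!: smooth_funs_add smooth_funs_bounded_linear[OF bounded_linear_mult_right])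
    ultimately show ?thesis
      using X Y by (auto simp: cvector_fields_def zero_fun_def intro!: ctangent_space_lincomb)
  qed
  show ?thesis
    unfolding vfield.subspace_def
    using 0 *[where Y = 0] *[where c = 1] by (auto simp: vfield.scale_one)
qed

text \<open>By convention tangent vectors kill non-smooth functions, so arbitrary \<open>f\<close>
  is covered. The Jacobi identity can then be checked for every \<open>f\<close> at once.\<close>

lemma cvector_fields_smooth:
  assumes M: "smooth_manifold n M \<A>" and X: "X \<in> cvector_fields n M \<A>"
  shows "(\<lambda>p. X p f) \<in> smooth_funs n M \<A>"
proof (cases "f \<in> smooth_funs n M \<A>")
  case False
  then have "X p f = 0" for p
    using X by (cases "p \<in> topspace M") (auto simp: cvector_fields_def ctangent_space_def)
  then show ?thesis using smooth_funs_const[OF M, of "0 :: complex"] by simp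
qed (use X in \<open>simp add: cvector_fields_def\<close>)

lemma cvector_fields_diff:
  assumes M: "smooth_manifold n M \<A>" and X: "X \<in> cvector_fields n M \<A>"
    and f: "f \<in> smooth_funs n M \<A>" and g: "g \<in> smooth_funs n M \<A>"
  shows "X p (\<lambda>q. f q - g q) = X p f - X p g"
proof (cases "p \<in> topspace M")
  case True
  have "(\<lambda>q. f q - g q) \<in> smooth_funs n M \<A>"
    using smooth_funs_add[OF f smooth_funs_bounded_linear[OF bounded_linear_minus[OF bounded_linear_ident] g]]
    by simp
  from ctangent_space_add[OF _ this g] True X show ?thesis
    by (fastforce simp: cvector_fields_def)
qed (use X in \<open>simp add: cvector_fields_def\<close>)

text \<open>Brackets are commutators of operators: once linearity of the outer fields is used, the
  twelve triple compositions cancel in pairs.\<close>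

lemma lie_bracket_jacobi:
  assumes M: "smooth_manifold n M \<A>"
    and X: "X \<in> cvector_fields n M \<A>" and Y: "Y \<in> cvector_fields n M \<A>" and Z: "Z \<in> cvector_fields n M \<A>"
  shows "lie_bracket (lie_bracket X Y) Z + lie_bracket (lie_bracket Y Z) X
    + lie_bracket (lie_bracket Z X) Y = 0"
  by (simp add: lie_bracket_def fun_eq_iff cvector_fields_smooth[OF M X] cvector_fields_smooth[OF M Y]
    cvector_fields_smooth[OF M Z] cvector_fields_diff[OF M X] cvector_fields_diff[OF M Y]
    cvector_fields_diff[OF M Z])

text \<open>Linearity over constants comes from the rules for smooth functions, applied to the
  cut-off constant \<open>?c\<close>; the Leibniz term drops out because fields annihilate
  \<open>?c\<close>.\<close>

lemma connection_cscale:
  assumes M: "smooth_manifold n M \<A>" and nab: "complex_connection n M \<A> nab"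
    and X: "X \<in> cvector_fields n M \<A>" and Y: "Y \<in> cvector_fields n M \<A>"
  shows "nab (cscale c X) Y = cscale c (nab X Y)" "nab X (cscale c Y) = cscale c (nab X Y)"
proof -
  let ?c = "\<lambda>p. if p \<in> topspace M then c else 0"
  have c: "?c \<in> smooth_funs n M \<A>" by (rule smooth_funs_const[OF M])
  have scale: "fmult ?c Z = cscale c Z" if "Z \<in> cvector_fields n M \<A>" for Z
    using that by (auto simp: fmult_def cscale_def cvector_fields_def fun_eq_iff)
  have XY: "nab X Y \<in> cvector_fields n M \<A>"
    using nab X Y by (auto simp: complex_connection_def Let_def)
  have "nab (fmult ?c X) Y = fmult ?c (nab X Y)"
    using nab X Y c unfolding complex_connection_def Let_def by blast
  then show "nab (cscale c X) Y = cscale c (nab X Y)" by (simp add: scale X XY)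
  have "nab X (fmult ?c Y) = fmult (\<lambda>p. X p ?c) Y + fmult ?c (nab X Y)"
    using nab X Y c unfolding complex_connection_def Let_def by blast
  moreover have "X p ?c = 0" for p
    using X ctangent_space_const[OF M, of p "X p" c]
    by (cases "p \<in> topspace M") (auto simp: cvector_fields_def)
  ultimately show "nab X (cscale c Y) = cscale c (nab X Y)"
    by (simp add: scale Y XY) (simp add: fmult_def fun_eq_iff)
qed

section \<open>Polarization\<close>

lemma additive_rules:
  assumes "Modules.additive f"
  shows "f (x + y) = f x + f y" "f (- x) = - f x" "f (x - y) = f x - f y" "f 0 = 0"
  using assms by (auto simp: Modules.additive.add Modules.additive.minus Modules.additive.diff Modules.additive.zero)

text \<open>Recursive form of the unnormalized sum over all permutations: each argument in turn is
  put first.\<close>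

definition sym2 where "sym2 f x y = f x y + f y x"

definition sym3 where "sym3 f x y z = sym2 (f x) y z + sym2 (f y) x z + sym2 (f z) x y"

definition sym4 where
  "sym4 f x y z u = sym3 (f x) y z u + sym3 (f y) x z u + sym3 (f z) x y u + sym3 (f u) x y z"

lemma polarize2:
  fixes f :: "'v::ab_group_add \<Rightarrow> 'v \<Rightarrow> complex"
  assumes "\<And>y. Modules.additive (\<lambda>x. f x y)" "\<And>x. Modules.additive (f x)"
    and sym: "\<And>x y. f x y = f y x" and diag: "\<And>x. f x x = 0"
  shows "f x y = 0"
proof -
  have "f (x + y) (x + y) = f x x + f x y + (f y x + f y y)"
    using assms(1,2)[THEN additive_rules(1)] by simp
  then show ?thesis using sym[of y x] by (simp add: diag)
qed

lemma polarize3: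
  fixes f :: "'v::ab_group_add \<Rightarrow> 'v \<Rightarrow> 'v \<Rightarrow> complex"
  assumes add: "\<And>y z. Modules.additive (\<lambda>x. f x y z)" "\<And>x z. Modules.additive (\<lambda>y. f x y z)"
      "\<And>x y. Modules.additive (f x y)"
    and sym: "\<And>x y z. f x y z = f y x z" "\<And>x y z. f x y z = f x z y" and diag: "\<And>x. f x x x = 0"
  shows "f x y z = 0"
proof (rule polarize2[of "f x"])
  fix w
  note rules = add[THEN additive_rules(1)]
  \<comment> \<open>Expansion of the vanishing diagonal value at \<open>x + v\<close>. The two terms
    have degree 1 and 2 in \<open>v\<close>, so comparing \<open>v = w\<close> with
    \<open>v = w + w\<close> separates them.\<close>
  have "3 * f x x v + 3 * f x v v = 0" for v
    using diag[of "x + v"] sym(1)[of v x v] sym(2)[of v v x] sym(2)[of v x x] sym(1)[of v x x] sym(2)[of x v x]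
    by (simp add: rules diag[of x] diag[of v] add.commute)
  from this[of w] this[of "w + w"]
  have "3 * f x x w + 3 * f x w w = 0" "6 * f x x w + 12 * f x w w = 0"
    by (simp_all add: rules diag)
  then show "f x w w = 0" by algebra
qed (rule add sym)+

text \<open>Polarization acts on \<open>u\<close> and \<open>v\<close> alone, with \<open>a\<close>,
  \<open>b\<close>, \<open>c\<close> fixed. At \<open>u = v = w\<close> every arrangement occurs
  twice, so the sum is twice the left side of \<open>diag\<close>.\<close>

lemma circ_sym3_polarize:
  fixes T :: "'v::ab_group_add \<Rightarrow> 'v \<Rightarrow> 'v \<Rightarrow> 'v \<Rightarrow> 'v \<Rightarrow> complex"
  assumes add: "\<And>a b y z. Modules.additive (\<lambda>x. T a b x y z)" "\<And>a b x z. Modules.additive (\<lambda>y. T a b x y z)"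
      "\<And>a b x y. Modules.additive (\<lambda>z. T a b x y z)"
    and diag: "\<And>a b c w. T a b c w w + T a b w c w + T a b w w c + (T b c a w w + T b c w a w + T b c w w a)
      + (T c a b w w + T c a w b w + T c a w w b) = 0"
  shows "sym3 (T a b) c u v + sym3 (T b c) a u v + sym3 (T c a) b u v = 0"
proof (rule polarize2[where f = "\<lambda>u v. sym3 (T a b) c u v + sym3 (T b c) a u v + sym3 (T c a) b u v"])
  fix w
  show "sym3 (T a b) c w w + sym3 (T b c) a w w + sym3 (T c a) b w w = 0"
    using diag[of a b c w] unfolding sym3_def sym2_def by algebra
qed (simp_all add: sym3_def sym2_def Modules.additive_def add[THEN additive_rules(1)] algebra_simps)

text \<open>With three equal entries every arrangement occurs six times, so the sum is six times the
  left side of \<open>diag\<close>.\<close>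

lemma circ_sym4_polarize:
  fixes T :: "'v::ab_group_add \<Rightarrow> 'v \<Rightarrow> 'v \<Rightarrow> 'v \<Rightarrow> 'v \<Rightarrow> 'v \<Rightarrow> complex"
  assumes add: "\<And>a b y z u. Modules.additive (\<lambda>x. T a b x y z u)" "\<And>a b x z u. Modules.additive (\<lambda>y. T a b x y z u)"
      "\<And>a b x y u. Modules.additive (\<lambda>z. T a b x y z u)" "\<And>a b x y z. Modules.additive (\<lambda>u. T a b x y z u)"
    and diag: "\<And>a b c w. T a b c w w w + T a b w c w w + T a b w w c w + T a b w w w c
      + (T b c a w w w + T b c w a w w + T b c w w a w + T b c w w w a)
      + (T c a b w w w + T c a w b w w + T c a w w b w + T c a w w w b) = 0"
  shows "sym4 (T a b) c u v t + sym4 (T b c) a u v t + sym4 (T c a) b u v t = 0"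
proof (rule polarize3[where f = "\<lambda>u v t. sym4 (T a b) c u v t + sym4 (T b c) a u v t + sym4 (T c a) b u v t"])
  fix w
  show "sym4 (T a b) c w w w + sym4 (T b c) a w w w + sym4 (T c a) b w w w = 0"
    using diag[of a b c w] unfolding sym4_def sym3_def sym2_def by algebra
qed (simp_all add: sym4_def sym3_def sym2_def Modules.additive_def add[THEN additive_rules(1)] algebra_simps)

section \<open>Curvature identities of a Lie admissible product\<close>

text \<open>\<open>N x y\<close> plays the covariant derivative of \<open>y\<close> along
  \<open>x\<close>. Torsion freeness is built in by taking the commutator of \<open>N\<close> as the
  bracket, and totality frees all identities from membership conditions.\<close>

locale lie_admissible =
  fixes N :: "'v::ab_group_add \<Rightarrow> 'v \<Rightarrow> 'v"
  assumes N_add_left: "N (x + y) z = N x z + N y z"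
    and N_add_right: "N x (y + z) = N x y + N x z"
    and jacobi: "N (N x y - N y x) z - N z (N x y - N y x) + N (N y z - N z y) x - N x (N y z - N z y)
      + N (N z x - N x z) y - N y (N z x - N x z) = 0"
begin

section \<open>Curvature and its covariant derivatives up to order three\<close>

definition R where "R x y z = N x (N y z) - N y (N x z) - N (N x y - N y x) z"

definition nabla3 where
  "nabla3 t p x y z = N p (t x y z) - t (N p x) y z - t x (N p y) z - t x y (N p z)"

definition nabla4 where
  "nabla4 t p x y z u = N p (t x y z u)
    - t (N p x) y z u - t x (N p y) z u - t x y (N p z) u - t x y z (N p u)"

definition nabla5 where
  "nabla5 t p x y z u v = N p (t x y z u v)
    - t (N p x) y z u v - t x (N p y) z u v - t x y (N p z) u v - t x y z (N p u) v - t x y z u (N p v)"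

definition DR where "DR = nabla3 R"
definition DDR where "DDR = nabla4 DR"
definition DDDR where "DDDR = nabla5 DDR"

lemma N_additive: "Modules.additive (\<lambda>x. N x y)" "Modules.additive (N x)"
  by (auto simp: Modules.additive_def N_add_left N_add_right)

lemmas N_linear = N_additive[THEN additive_rules(1)] N_additive[THEN additive_rules(2)]
  N_additive[THEN additive_rules(3)] N_additive[THEN additive_rules(4)]

lemma R_additive:
  "Modules.additive (\<lambda>x. R x y z)" "Modules.additive (\<lambda>y. R x y z)" "Modules.additive (\<lambda>z. R x y z)"
  by (auto simp: Modules.additive_def R_def N_linear algebra_simps)

lemmas R_linear = R_additive[THEN additive_rules(1)] R_additive[THEN additive_rules(2)]
  R_additive[THEN additive_rules(3)] R_additive[THEN additive_rules(4)]

lemma DR_additive: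
  "Modules.additive (\<lambda>p. DR p x y z)" "Modules.additive (\<lambda>x. DR p x y z)"
  "Modules.additive (\<lambda>y. DR p x y z)" "Modules.additive (\<lambda>z. DR p x y z)"
  by (auto simp: Modules.additive_def DR_def nabla3_def N_linear R_linear algebra_simps)

lemmas DR_linear = DR_additive[THEN additive_rules(1)] DR_additive[THEN additive_rules(2)]
  DR_additive[THEN additive_rules(3)] DR_additive[THEN additive_rules(4)]

lemma DDR_additive:
  "Modules.additive (\<lambda>p. DDR p q x y z)" "Modules.additive (\<lambda>q. DDR p q x y z)" "Modules.additive (\<lambda>x. DDR p q x y z)"
  "Modules.additive (\<lambda>y. DDR p q x y z)" "Modules.additive (\<lambda>z. DDR p q x y z)"
  by (auto simp: Modules.additive_def DDR_def nabla4_def N_linear DR_linear algebra_simps)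

lemmas DDR_linear = DDR_additive[THEN additive_rules(1)] DDR_additive[THEN additive_rules(2)]
  DDR_additive[THEN additive_rules(3)] DDR_additive[THEN additive_rules(4)]

lemma DDDR_additive:
  "Modules.additive (\<lambda>p. DDDR p q r x y z)" "Modules.additive (\<lambda>q. DDDR p q r x y z)" "Modules.additive (\<lambda>r. DDDR p q r x y z)"
  "Modules.additive (\<lambda>x. DDDR p q r x y z)" "Modules.additive (\<lambda>y. DDDR p q r x y z)" "Modules.additive (\<lambda>z. DDDR p q r x y z)"
  by (auto simp: Modules.additive_def DDDR_def nabla5_def N_linear DDR_linear algebra_simps)

lemmas DDDR_linear = DDDR_additive[THEN additive_rules(1)] DDDR_additive[THEN additive_rules(2)]
  DDDR_additive[THEN additive_rules(3)] DDDR_additive[THEN additive_rules(4)]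

section \<open>Skewness, Bianchi and Ricci identities\<close>

lemma R_skew: "R x y z = - R y x z"
  by (simp add: R_def N_linear)

lemma DR_skew: "DR p x y z = - DR p y x z"
  by (simp add: DR_def nabla3_def N_linear R_skew[of x] R_skew[of "N p x"])

lemma DDR_skew: "DDR p q x y z = - DDR p q y x z"
  by (simp add: DDR_def nabla4_def N_linear DR_skew[of _ x] DR_skew[of _ "N p x"])

lemma DDDR_skew: "DDDR p q r x y z = - DDDR p q r y x z"
  by (simp add: DDDR_def nabla5_def N_linear DDR_skew[of _ _ x] DDR_skew[of _ _ "N p x"])

text \<open>Computed from the definition: skewness yields only \<open>R x x z + R x x z = 0\<close>,
  which does not force vanishing in an abelian group with 2-torsion.\<close>

lemma R_diag: "R x x z = 0"
  by (simp add: R_def N_linear)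

lemma DR_diag: "DR p x x z = 0"
  using R_skew[of x "N p x" z] by (simp add: DR_def nabla3_def N_linear R_diag)

lemma DDR_diag: "DDR p q x x z = 0"
  using DR_skew[of q x "N p x" z] by (simp add: DDR_def nabla4_def N_linear DR_diag)

lemma DDDR_diag: "DDDR p q r x x z = 0"
  using DDR_skew[of q r x "N p x" z] by (simp add: DDDR_def nabla5_def N_linear DDR_diag)

text \<open>The cyclic sum is the negative of the Jacobi expression of the commutator.\<close>

lemma R_bianchi: "R x y z + R y z x + R z x y = 0"
  using jacobi[of x y z] by (simp add: R_def N_linear algebra_simps)

text \<open>Covariant differentiation of the identity for \<open>R\<close>: grouped by the entry
  that \<open>N p\<close> hits, every group is again a cyclic sum of lower order.\<close>

lemma DR_bianchi: "DR p x y z + DR p y z x + DR p z x y = 0"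
proof -
  have "DR p x y z + DR p y z x + DR p z x y = N p (R x y z + R y z x + R z x y)
    - (R (N p x) y z + R y z (N p x) + R z (N p x) y)
    - (R (N p y) z x + R z x (N p y) + R x (N p y) z)
    - (R (N p z) x y + R x y (N p z) + R y (N p z) x)"
    by (simp add: DR_def nabla3_def N_linear algebra_simps)
  then show ?thesis by (simp add: R_bianchi N_linear)
qed

lemma DDR_bianchi: "DDR p q x y z + DDR p q y z x + DDR p q z x y = 0"
proof -
  have "DDR p q x y z + DDR p q y z x + DDR p q z x y = N p (DR q x y z + DR q y z x + DR q z x y)
    - (DR (N p q) x y z + DR (N p q) y z x + DR (N p q) z x y)
    - (DR q (N p x) y z + DR q y z (N p x) + DR q z (N p x) y)
    - (DR q (N p y) z x + DR q z x (N p y) + DR q x (N p y) z)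
    - (DR q (N p z) x y + DR q x y (N p z) + DR q y (N p z) x)"
    by (simp add: DDR_def nabla4_def N_linear algebra_simps)
  then show ?thesis by (simp add: DR_bianchi N_linear)
qed

lemma DDDR_bianchi: "DDDR p q r x y z + DDDR p q r y z x + DDDR p q r z x y = 0"
proof -
  have "DDDR p q r x y z + DDDR p q r y z x + DDDR p q r z x y
    = N p (DDR q r x y z + DDR q r y z x + DDR q r z x y)
    - (DDR (N p q) r x y z + DDR (N p q) r y z x + DDR (N p q) r z x y)
    - (DDR q (N p r) x y z + DDR q (N p r) y z x + DDR q (N p r) z x y)
    - (DDR q r (N p x) y z + DDR q r y z (N p x) + DDR q r z (N p x) y)
    - (DDR q r (N p y) z x + DDR q r z x (N p y) + DDR q r x (N p y) z)
    - (DDR q r (N p z) x y + DDR q r x y (N p z) + DDR q r y (N p z) x)"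
    by (simp add: DDDR_def nabla5_def N_linear algebra_simps)
  then show ?thesis by (simp add: DDR_bianchi N_linear)
qed

text \<open>Second Bianchi identity: everything cancels except the Jacobi expression, which acts on
  \<open>u\<close> through \<open>N\<close>.\<close>

lemma DR_bianchi2: "DR x y z u + DR y z x u + DR z x y u = 0"
proof -
  have "DR x y z u + DR y z x u + DR z x y u
    = N (N (N x y - N y x) z - N z (N x y - N y x) + N (N y z - N z y) x - N x (N y z - N z y)
      + N (N z x - N x z) y - N y (N z x - N x z)) u"
    by (simp add: DR_def nabla3_def R_def N_linear algebra_simps)
  also have "\<dots> = 0"
    unfolding jacobi by (simp add: N_linear)
  finally show ?thesis .
qed

lemma DDR_bianchi2: "DDR p x y z u + DDR p y z x u + DDR p z x y u = 0"
proof -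
  have "DDR p x y z u + DDR p y z x u + DDR p z x y u = N p (DR x y z u + DR y z x u + DR z x y u)
    - (DR (N p x) y z u + DR y z (N p x) u + DR z (N p x) y u)
    - (DR (N p y) z x u + DR z x (N p y) u + DR x (N p y) z u)
    - (DR (N p z) x y u + DR x y (N p z) u + DR y (N p z) x u)
    - (DR x y z (N p u) + DR y z x (N p u) + DR z x y (N p u))"
    by (simp add: DDR_def nabla4_def N_linear algebra_simps)
  then show ?thesis by (simp add: DR_bianchi2 N_linear)
qed

lemma DDDR_bianchi2: "DDDR p q x y z u + DDDR p q y z x u + DDDR p q z x y u = 0"
proof -
  have "DDDR p q x y z u + DDDR p q y z x u + DDDR p q z x y u
    = N p (DDR q x y z u + DDR q y z x u + DDR q z x y u)
    - (DDR (N p q) x y z u + DDR (N p q) y z x u + DDR (N p q) z x y u)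
    - (DDR q (N p x) y z u + DDR q y z (N p x) u + DDR q z (N p x) y u)
    - (DDR q (N p y) z x u + DDR q z x (N p y) u + DDR q x (N p y) z u)
    - (DDR q (N p z) x y u + DDR q x y (N p z) u + DDR q y (N p z) x u)
    - (DDR q x y z (N p u) + DDR q y z x (N p u) + DDR q z x y (N p u))"
    by (simp add: DDDR_def nabla5_def N_linear algebra_simps)
  then show ?thesis by (simp add: DDR_bianchi2 N_linear)
qed

text \<open>The terms with \<open>N p q\<close> and \<open>N q p\<close> assemble to the bracket, so
  the commutator of the two derivatives is \<open>R p q\<close> acting on the tensor
  \<open>R\<close> as a derivation.\<close>

lemma DDR_ricci:
  "DDR p q x y z - DDR q p x y z
    = R p q (R x y z) - R (R p q x) y z - R x (R p q y) z - R x y (R p q z)"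
  by (simp add: DDR_def nabla4_def DR_def nabla3_def N_linear R_linear R_def[of p q] algebra_simps)

lemma DDDR_ricci:
  "DDDR p q r x y z - DDDR q p r x y z
    = R p q (DR r x y z) - DR (R p q r) x y z - DR r (R p q x) y z - DR r x (R p q y) z
      - DR r x y (R p q z)"
  by (simp add: DDDR_def nabla5_def DDR_def nabla4_def N_linear DR_linear R_def[of p q] algebra_simps)

text \<open>Covariant derivative of \<open>DDR_ricci\<close> along \<open>r\<close>: the curvature
  operator itself is differentiated too, which accounts for the first four terms.\<close>

lemma DDDR_ricci_inner:
  "DDDR r p q x y z - DDDR r q p x y z
    = DR r p q (R x y z) - R (DR r p q x) y z - R x (DR r p q y) z - R x y (DR r p q z)
      + R p q (DR r x y z) - DR r (R p q x) y z - DR r x (R p q y) z - DR r x y (R p q z)"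
proof -
  let ?E = "\<lambda>p q x y z. R p q (R x y z) - R (R p q x) y z - R x (R p q y) z - R x y (R p q z)"
  have "DDDR r p q x y z - DDDR r q p x y z
    = N r (DDR p q x y z - DDR q p x y z)
      - (DDR (N r p) q x y z - DDR q (N r p) x y z) - (DDR p (N r q) x y z - DDR (N r q) p x y z)
      - (DDR p q (N r x) y z - DDR q p (N r x) y z) - (DDR p q x (N r y) z - DDR q p x (N r y) z)
      - (DDR p q x y (N r z) - DDR q p x y (N r z))"
    by (simp add: DDDR_def nabla5_def N_linear algebra_simps)
  also have "\<dots> = N r (?E p q x y z) - ?E (N r p) q x y z - ?E p (N r q) x y z
    - ?E p q (N r x) y z - ?E p q x (N r y) z - ?E p q x y (N r z)"
    by (simp only: DDR_ricci)
  also have "\<dots> = DR r p q (R x y z) - R (DR r p q x) y z - R x (DR r p q y) z - R x y (DR r p q z)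
      + R p q (DR r x y z) - DR r (R p q x) y z - DR r x (R p q y) z - DR r x y (R p q z)"
    by (simp add: DR_def nabla3_def N_linear R_linear algebra_simps)
  finally show ?thesis .
qed


definition J where "J x = sym2 (R x)"

definition DJ where "DJ p x = sym2 (DR p x)"

definition K where "K x = sym3 (\<lambda>p. DR p x)"

text \<open>
  These are the curried forms of \<open>d\<^sub>1(\<nabla>R)\<^sub>2\<close>, \<open>J \<and>\<^sub>1 J\<close>, \<open>d\<^sub>1d\<^sub>1(\<nabla>R)\<^sub>2\<close>, \<open>\<nabla>(J \<and>\<^sub>1 J)\<close>, \<open>d\<^sub>1(J \<and>\<^sub>1 J)\<close>,
  \<open>J \<and>\<^sub>1 K\<close> and \<open>K \<and>\<^sub>1 J\<close>.
\<close>

definition dDR where "dDR a b x y z = DDR a x b y z - DDR b x a y z"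

definition JJ where "JJ a b x y z = J a (J b x y) z - J b (J a x y) z"

definition ddDR where
  "ddDR a b x y z u = DDDR a b y x z u - DDDR a x y b z u - (DDDR b a y x z u - DDDR b x y a z u)"

definition DJJ where
  "DJJ p a b x y z = DJ p a (J b x y) z + J a (DJ p b x y) z - DJ p b (J a x y) z - J b (DJ p a x y) z"

definition dJJ where "dJJ a b x y z u = DJJ a b x y z u - DJJ b a x y z u"

definition JK where "JK a b x y z u = J a (K b x y z) u - J b (K a x y z) u"

definition KJ where "KJ a b x y z u = K a (J b x y) z u - K b (J a x y) z u"

section \<open>Certificates and the vanishing of the circular sums\<close>

lemmas skew = R_skew DR_skew DDR_skew DDDR_skew

text \<open>Together with \<open>add_eq\<close> this forms linear combinations of identities. The
  functional \<open>ev\<close> carries them from the group into the complex numbers, where they can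
  be scaled and compared algebraically.\<close>

lemma scaled: "x = y \<Longrightarrow> c * ev x = c * ev y" for ev :: "'v \<Rightarrow> complex"
  by simp

lemma add_eq: "x = y \<Longrightarrow> z = t \<Longrightarrow> x + z = y + t" for x :: complex
  by simp

text \<open>
  The two certificates were found by linear algebra over the rationals. Summed over the cyclic
  permutations of \<open>a\<close>, \<open>b\<close>, \<open>c\<close>, each adds up to the vanishing of the circular sum at equal
  remaining entries \<open>w\<close>.
\<close>

lemmas certificate4 =
  DDR_bianchi[of a w b c w, THEN scaled[of _ _ "- 3" ev],
    THEN add_eq, OF R_bianchi[of "R a w w" b c, THEN scaled[of _ _ "- 4" ev]],
    THEN add_eq, OF DDR_bianchi2[of a b c w w, THEN scaled[of _ _ "9" ev]],
    THEN add_eq, OF R_bianchi[of b c w, THEN arg_cong[of _ _ "R a w"], THEN scaled[of _ _ "4" ev]],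
    THEN add_eq, OF R_bianchi[of a b c, THEN arg_cong[of _ _ "\<lambda>v. R v w w"], THEN scaled[of _ _ "4" ev]],
    THEN add_eq, OF R_bianchi[of a b w, THEN arg_cong[of _ _ "\<lambda>v. R v c w"], THEN scaled[of _ _ "- 4" ev]],
    THEN add_eq, OF DDR_ricci[of a b c w w, THEN scaled[of _ _ "- 12" ev]]]
  for a b c w and ev :: "'v \<Rightarrow> complex"

lemmas certificate5 =
  DR_bianchi[of b "R a w w" c w, THEN scaled[of _ _ "- 48" ev],
    THEN add_eq, OF DR_bianchi[of c "R a w w" b w, THEN scaled[of _ _ "48" ev]],
    THEN add_eq, OF DR_bianchi[of w "R a w w" b c, THEN scaled[of _ _ "60" ev]],
    THEN add_eq, OF DR_bianchi[of "R a w w" b c w, THEN scaled[of _ _ "60" ev]],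
    THEN add_eq, OF DDDR_bianchi[of a w w b c w, THEN scaled[of _ _ "36" ev]],
    THEN add_eq, OF R_bianchi[of "DR a b w w" c w, THEN scaled[of _ _ "48" ev]],
    THEN add_eq, OF R_bianchi[of "DR a c w w" b w, THEN scaled[of _ _ "- 48" ev]],
    THEN add_eq, OF R_bianchi[of "DR w a w w" b c, THEN scaled[of _ _ "60" ev]],
    THEN add_eq, OF DR_bianchi2[of b c w "R a w w", THEN scaled[of _ _ "- 180" ev]],
    THEN add_eq, OF DR_bianchi2[of "R a w w" b c w, THEN scaled[of _ _ "- 180" ev]],
    THEN add_eq, OF DDDR_bianchi2[of a w b c w w, THEN scaled[of _ _ "- 108" ev]],
    THEN add_eq, OF R_bianchi[of a b w, THEN arg_cong[of _ _ "\<lambda>v. DR v c w w"],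
      THEN scaled[of _ _ "- 60" ev]],
    THEN add_eq, OF R_bianchi[of a b c, THEN arg_cong[of _ _ "\<lambda>v. DR w v w w"],
      THEN scaled[of _ _ "- 60" ev]],
    THEN add_eq, OF R_bianchi[of a b w, THEN arg_cong[of _ _ "\<lambda>v. DR c v w w"],
      THEN scaled[of _ _ "- 96" ev]],
    THEN add_eq, OF R_bianchi[of a b w, THEN arg_cong[of _ _ "\<lambda>v. DR w v c w"],
      THEN scaled[of _ _ "60" ev]],
    THEN add_eq, OF R_bianchi[of a b w, THEN arg_cong[of _ _ "\<lambda>v. DR w c w v"],
      THEN scaled[of _ _ "- 60" ev]],
    THEN add_eq, OF DDDR_ricci_inner[of a b w c w w, THEN scaled[of _ _ "- 144" ev]],
    THEN add_eq, OF DDDR_ricci_inner[of a c w b w w, THEN scaled[of _ _ "144" ev]],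
    THEN add_eq, OF DR_bianchi[of a b c w, THEN arg_cong[of _ _ "\<lambda>v. R v w w"],
      THEN scaled[of _ _ "- 96" ev]],
    THEN add_eq, OF DR_bianchi[of w a b w, THEN arg_cong[of _ _ "\<lambda>v. R v c w"],
      THEN scaled[of _ _ "60" ev]],
    THEN add_eq, OF DR_bianchi2[of a b w w, THEN arg_cong[of _ _ "\<lambda>v. R v c w"],
      THEN scaled[of _ _ "- 180" ev]],
    THEN add_eq, OF DR_bianchi[of w a b w, THEN arg_cong[of _ _ "\<lambda>v. R c w v"],
      THEN scaled[of _ _ "- 60" ev]],
    THEN add_eq, OF DR_bianchi2[of a b w w, THEN arg_cong[of _ _ "\<lambda>v. R c w v"],
      THEN scaled[of _ _ "180" ev]],
    THEN add_eq, OF DDDR_ricci[of a b w c w w, THEN scaled[of _ _ "180" ev]]]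
  for a b c w and ev :: "'v \<Rightarrow> complex"

text \<open>Scaled so that all coefficients are integers; later \<open>ev\<close> evaluates a field
  at a point and a function.\<close>

definition T4 :: "('v \<Rightarrow> complex) \<Rightarrow> 'v \<Rightarrow> 'v \<Rightarrow> 'v \<Rightarrow> 'v \<Rightarrow> 'v \<Rightarrow> complex" where
  "T4 ev a b x y z = 3 * ev (dDR a b x y z) - 2 * ev (JJ a b x y z)"

definition T5 :: "('v \<Rightarrow> complex) \<Rightarrow> 'v \<Rightarrow> 'v \<Rightarrow> 'v \<Rightarrow> 'v \<Rightarrow> 'v \<Rightarrow> 'v \<Rightarrow> complex" where
  "T5 ev a b x y z u = 36 * ev (ddDR a b x y z u) - 24 * ev (dJJ a b x y z u)
    + 10 * ev (JK a b x y z u) + 15 * ev (KJ a b x y z u)"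

text \<open>Reduces a goal \<open>z = 0\<close> to a formal identity: \<open>z\<close> has to agree
  with the difference of the two sides of a known equation.\<close>

lemma eq_zero_if_diff: "x = y \<Longrightarrow> z - (x - y) = 0 \<Longrightarrow> z = 0" for x y z :: complex
  by simp

lemma circ_sym_T4_diag:
  assumes ev: "Modules.additive ev"
  shows "T4 ev a b c w w + T4 ev a b w c w + T4 ev a b w w c
    + (T4 ev b c a w w + T4 ev b c w a w + T4 ev b c w w a)
    + (T4 ev c a b w w + T4 ev c a w b w + T4 ev c a w w b) = 0"
proof -
  \<comment> \<open>Normal form for the skew pair: order \<open>a\<close>, \<open>b\<close>,
    \<open>c\<close>, \<open>w\<close>, with curvature values in front. Equal values then become
    equal atoms, and what remains is linear in them.\<close>
  note ordered = skew[where x=w] R_skew[of b a] R_skew[of c a] R_skew[of c b]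
    DR_skew[of _ b a] DR_skew[of _ c a] DR_skew[of _ c b]
    DDR_skew[of _ _ b a] DDR_skew[of _ _ c a] DDR_skew[of _ _ c b]
    R_skew[where y="R _ _ _"]
  note cert = certificate4[where a=a and b=b and c=c and w=w and ev=ev,
    THEN add_eq, OF certificate4[where a=b and b=c and c=a and w=w and ev=ev],
    THEN add_eq, OF certificate4[where a=c and b=a and c=b and w=w and ev=ev]]
  show ?thesis
    unfolding T4_def dDR_def JJ_def J_def sym2_def
    apply (rule eq_zero_if_diff[OF cert])
    apply (simp only: R_linear DR_linear DDR_linear additive_rules[OF ev] R_diag DR_diag DDR_diag ordered minus_minus)
    apply algebra
    done
qed

lemma circ_sym_T5_diag:
  assumes ev: "Modules.additive ev"
  shows "T5 ev a b c w w w + T5 ev a b w c w w + T5 ev a b w w c w + T5 ev a b w w w c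
    + (T5 ev b c a w w w + T5 ev b c w a w w + T5 ev b c w w a w + T5 ev b c w w w a)
    + (T5 ev c a b w w w + T5 ev c a w b w w + T5 ev c a w w b w + T5 ev c a w w w b) = 0"
proof -
  note ordered = skew[where x=w] R_skew[of b a] R_skew[of c a] R_skew[of c b]
    DR_skew[of _ b a] DR_skew[of _ c a] DR_skew[of _ c b]
    DDR_skew[of _ _ b a] DDR_skew[of _ _ c a] DDR_skew[of _ _ c b]
    DDDR_skew[of _ _ _ b a] DDDR_skew[of _ _ _ c a] DDDR_skew[of _ _ _ c b]
    R_skew[where y="R _ _ _"] R_skew[where y="DR _ _ _ _"] DR_skew[where y="R _ _ _"]
  note cert = certificate5[where a=a and b=b and c=c and w=w and ev=ev,
    THEN add_eq, OF certificate5[where a=b and b=c and c=a and w=w and ev=ev],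
    THEN add_eq, OF certificate5[where a=c and b=a and c=b and w=w and ev=ev]]
  show ?thesis
    unfolding T5_def ddDR_def dJJ_def DJJ_def JK_def KJ_def J_def DJ_def K_def sym3_def sym2_def
    apply (rule eq_zero_if_diff[OF cert])
    apply (simp only: R_linear DR_linear DDR_linear DDDR_linear additive_rules[OF ev]
      R_diag DR_diag DDR_diag DDDR_diag ordered minus_minus)
    apply algebra
    done
qed

lemma T4_additive:
  assumes ev: "Modules.additive ev"
  shows "Modules.additive (\<lambda>x. T4 ev a b x y z)" "Modules.additive (\<lambda>y. T4 ev a b x y z)"
    "Modules.additive (\<lambda>z. T4 ev a b x y z)"
  by (simp_all add: Modules.additive_def T4_def dDR_def JJ_def J_def sym2_def
    R_linear DDR_linear additive_rules[OF ev] algebra_simps)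

lemma T5_additive:
  assumes ev: "Modules.additive ev"
  shows "Modules.additive (\<lambda>x. T5 ev a b x y z u)" "Modules.additive (\<lambda>y. T5 ev a b x y z u)"
    "Modules.additive (\<lambda>z. T5 ev a b x y z u)" "Modules.additive (\<lambda>u. T5 ev a b x y z u)"
proof -
  note defs = Modules.additive_def T5_def ddDR_def dJJ_def DJJ_def JK_def KJ_def J_def DJ_def K_def sym3_def sym2_def
    R_linear DR_linear DDDR_linear additive_rules[OF ev]
  show "Modules.additive (\<lambda>x. T5 ev a b x y z u)" "Modules.additive (\<lambda>y. T5 ev a b x y z u)"
    "Modules.additive (\<lambda>z. T5 ev a b x y z u)" "Modules.additive (\<lambda>u. T5 ev a b x y z u)"
    by (simp only: defs, intro allI, algebra)+
qed

lemmas circ_sym_T4 = circ_sym3_polarize[OF T4_additive circ_sym_T4_diag]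
lemmas circ_sym_T5 = circ_sym4_polarize[OF T5_additive circ_sym_T5_diag]

end

section \<open>The tensors of a torsion free connection\<close>

lemma tscale_eq: "tscale c \<theta> vs = cscale c (\<theta> vs)"
  by (simp add: tscale_def cscale_def)

lemma id1_pow_simps:
  "id1_pow nab 0 A = A" "id1_pow nab (Suc 0) A = tscale \<i> (d1 nab A)"
  "id1_pow nab 2 A = tscale \<i> (d1 nab (tscale \<i> (d1 nab A)))"
  by (simp_all add: id1_pow_def numeral_2_eq_2)

text \<open>Permutations are expanded by splitting off one point of the interval at a time. The
  bound keeps the form \<open>2 + 1\<close> in which it arises from \<open>S_of\<close>.\<close>

lemma Sym_2_3: "Sym {2..2 + 1} \<theta> [a, x, y] = sym2 (\<lambda>x y. \<theta> [a, x, y]) x y"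
proof -
  have "{2..2 + 1} = insert 2 {3 :: nat}" by auto
  then show ?thesis
    unfolding Sym_def
    by (simp add: sum_over_permutations_insert permutes_sing upt_rec numeral_eq_Suc sym2_def)
qed

lemma Sym_2_4: "Sym {2..3 + 1} \<theta> [a, x, y, z] = sym3 (\<lambda>x y z. \<theta> [a, x, y, z]) x y z"
proof -
  have "{2..3 + 1} = insert 2 (insert 3 {4 :: nat})" by auto
  then show ?thesis
    unfolding Sym_def
    by (simp add: sum_over_permutations_insert permutes_sing upt_rec numeral_eq_Suc sym2_def sym3_def
      transpose_def ac_simps)
qed

lemma Sym_3_5: "Sym {3..4 + 1} \<theta> [a, b, x, y, z] = sym3 (\<lambda>x y z. \<theta> [a, b, x, y, z]) x y z"
proof -
  have "{3..4 + 1} = insert 3 (insert 4 {5 :: nat})" by auto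
  then show ?thesis
    unfolding Sym_def
    by (simp add: sum_over_permutations_insert permutes_sing upt_rec numeral_eq_Suc sym2_def sym3_def
      transpose_def ac_simps)
qed

lemma Sym_3_6: "Sym {3..5 + 1} \<theta> [a, b, x, y, z, u] = sym4 (\<lambda>x y z u. \<theta> [a, b, x, y, z, u]) x y z u"
proof -
  have "{3..5 + 1} = insert 3 (insert 4 (insert 5 {6 :: nat}))" by auto
  then show ?thesis
    unfolding Sym_def
    by (simp add: sum_over_permutations_insert permutes_sing upt_rec numeral_eq_Suc sym2_def sym3_def
      sym4_def transpose_def ac_simps)
qed

section \<open>A total product from the connection\<close>

locale torsion_free_connection =
  fixes n :: nat and M :: "'a topology" and \<A> :: "'a atlas"
    and nab :: "'a vfield \<Rightarrow> 'a vfield \<Rightarrow> 'a vfield"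
  assumes manifold: "smooth_manifold n M \<A>"
    and connection: "complex_connection n M \<A> nab"
    and torsion: "torsion_free n M \<A> nab"
begin

abbreviation "\<X> \<equiv> cvector_fields n M \<A>"

lemmas subspace = subspace_cvector_fields[OF manifold]

lemmas \<X>_add [simp] = vfield.subspace_add[OF subspace]
lemmas \<X>_diff [simp] = vfield.subspace_diff[OF subspace]
lemmas \<X>_minus [simp] = vfield.subspace_neg[OF subspace]
lemmas \<X>_scale [simp] = vfield.subspace_scale[OF subspace]

lemma nab_in: "x \<in> \<X> \<Longrightarrow> y \<in> \<X> \<Longrightarrow> nab x y \<in> \<X>"
  and nab_add_left: "x \<in> \<X> \<Longrightarrow> x' \<in> \<X> \<Longrightarrow> y \<in> \<X> \<Longrightarrow> nab (x + x') y = nab x y + nab x' y"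
  and nab_add_right: "x \<in> \<X> \<Longrightarrow> y \<in> \<X> \<Longrightarrow> y' \<in> \<X> \<Longrightarrow> nab x (y + y') = nab x y + nab x y'"
  using connection by (simp_all add: complex_connection_def Let_def)

text \<open>An arbitrary complex linear projection onto the vector fields, obtained as a left
  inverse of the inclusion. Applying it to both arguments of \<open>nab\<close> makes the connection
  total and changes nothing on vector fields.\<close>

definition P :: "'a vfield \<Rightarrow> 'a vfield" where
  "P = (SOME g. range g \<subseteq> \<X> \<and> Vector_Spaces.linear cscale cscale g \<and> (\<forall>v\<in>\<X>. g v = v))"

lemma P: "range P \<subseteq> \<X>" "Vector_Spaces.linear cscale cscale P" "\<forall>v\<in>\<X>. P v = v"
proof -
  interpret vector_space_pair cscale cscale by unfold_locales
  have "Vector_Spaces.linear cscale cscale (\<lambda>v. v)"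
    by (simp add: Vector_Spaces.linear_iff vfield.vector_space_axioms)
  from someI_ex[OF linear_exists_left_inverse_on[OF this subspace inj_on_id2]]
  show "range P \<subseteq> \<X>" "Vector_Spaces.linear cscale cscale P" "\<forall>v\<in>\<X>. P v = v"
    unfolding P_def by blast+
qed

lemma P_in [simp]: "P x \<in> \<X>"
  using P(1) by blast

lemma P_id [simp]: "x \<in> \<X> \<Longrightarrow> P x = x"
  using P(3) by blast

lemma P_add: "P (x + y) = P x + P y" and P_scale: "P (cscale c x) = cscale c (P x)"
  using P(2) by (simp_all add: Vector_Spaces.linear_iff)

definition N where "N x y = nab (P x) (P y)"

lemma N_in [simp]: "N x y \<in> \<X>"
  by (simp add: N_def nab_in)

lemma N_bracket: "N x y - N y x = lie_bracket (P x) (P y)"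
  using torsion by (simp add: N_def torsion_free_def)

text \<open>The inner commutator is itself a vector field, so \<open>P\<close> fixes it and iterated
  commutators of \<open>N\<close> are iterated Lie brackets. This carries the Jacobi identity over
  to \<open>N\<close>.\<close>

lemma N_commutator: "N (N x y - N y x) z - N z (N x y - N y x) = lie_bracket (lie_bracket (P x) (P y)) (P z)"
  using N_bracket[of "N x y - N y x" z] by (simp add: N_bracket[of x y, symmetric])

sublocale lie_admissible N
proof
  show "N (x + y) z = N x z + N y z" "N x (y + z) = N x y + N x z" for x y z
    by (simp_all add: N_def P_add nab_add_left nab_add_right)
  show "N (N x y - N y x) z - N z (N x y - N y x) + N (N y z - N z y) x - N x (N y z - N z y)
      + N (N z x - N x z) y - N y (N z x - N x z) = 0" for x y z
    using lie_bracket_jacobi[OF manifold P_in[of x] P_in[of y] P_in[of z]]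
    unfolding N_commutator[symmetric] by (simp add: algebra_simps)
qed

text \<open>Lets the scalar factors of the \<open>S_of\<close> tensors be pulled out of products and
  derivatives.\<close>

lemma N_scale: "N (cscale c x) y = cscale c (N x y)" "N x (cscale c y) = cscale c (N x y)"
  by (simp_all add: N_def P_scale connection_cscale[OF manifold connection])

lemmas scale_simps = vfield.scale_right_distrib vfield.scale_right_diff_distrib vfield.scale_minus_right
  vfield.scale_scale

lemma R_scale: "R (cscale c x) y z = cscale c (R x y z)" "R x (cscale c y) z = cscale c (R x y z)" "R x y (cscale c z) = cscale c (R x y z)"
  by (simp_all add: R_def N_scale scale_simps flip: vfield.scale_right_diff_distrib)

lemma DR_scale: "DR (cscale c p) x y z = cscale c (DR p x y z)"
  "DR p x (cscale c y) z = cscale c (DR p x y z)" "DR p x y (cscale c z) = cscale c (DR p x y z)"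
  by (simp_all add: DR_def nabla3_def N_scale R_scale scale_simps)

lemma R_in [simp]: "R x y z \<in> \<X>"
  by (simp add: R_def)

lemma DR_in [simp]: "DR p x y z \<in> \<X>"
  by (simp add: DR_def nabla3_def)

lemma DDR_in [simp]: "DDR p q x y z \<in> \<X>"
  by (simp add: DDR_def nabla4_def)

lemma J_in [simp]: "J x y z \<in> \<X>"
  by (simp add: J_def sym2_def)

lemma K_in [simp]: "K x y z u \<in> \<X>"
  by (simp add: K_def sym3_def sym2_def)

lemma JJ_in [simp]: "JJ a b x y z \<in> \<X>"
  by (simp add: JJ_def)

lemma dDR_in [simp]: "dDR a b x y z \<in> \<X>"
  by (simp add: dDR_def)

lemma J_scale: "J x (cscale c y) z = cscale c (J x y z)"
  by (simp add: J_def sym2_def R_scale scale_simps)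

lemma K_scale: "K x (cscale c y) z u = cscale c (K x y z u)"
  by (simp add: K_def sym3_def sym2_def DR_scale scale_simps)

lemma nab_eq_N: "x \<in> \<X> \<Longrightarrow> y \<in> \<X> \<Longrightarrow> nab x y = N x y"
  by (simp add: N_def)

declare curvature.simps [simp del] cov_deriv.simps [simp del] d1.simps [simp del] wedge1.simps [simp del]

section \<open>Translation of tensors on lists into curried ones\<close>

lemma curvature_eq:
  assumes "x \<in> \<X>" "y \<in> \<X>" "z \<in> \<X>"
  shows "curvature nab [x, y, z] = R x y z"
proof -
  have "lie_bracket x y = N x y - N y x"
    using assms N_bracket[of x y] by simp
  then show ?thesis using assms by (simp add: R_def nab_eq_N curvature.simps)
qed

text \<open>The hypothesis also asks for values in \<open>\<X>\<close>, since \<open>nab\<close> is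
  replaced by \<open>N\<close> on vector fields only.\<close>

lemma cov_deriv_3:
  assumes "\<And>x y z. x \<in> \<X> \<Longrightarrow> y \<in> \<X> \<Longrightarrow> z \<in> \<X> \<Longrightarrow> \<theta> [x, y, z] = t x y z \<and> t x y z \<in> \<X>"
    and "p \<in> \<X>" "x \<in> \<X>" "y \<in> \<X>" "z \<in> \<X>"
  shows "cov_deriv nab \<theta> [p, x, y, z] = nabla3 t p x y z"
  using assms by (simp add: cov_deriv.simps nab_eq_N nabla3_def lessThan_Suc algebra_simps)

lemma cov_deriv_4:
  assumes "\<And>x y z u. x \<in> \<X> \<Longrightarrow> y \<in> \<X> \<Longrightarrow> z \<in> \<X> \<Longrightarrow> u \<in> \<X> \<Longrightarrow> \<theta> [x, y, z, u] = t x y z u \<and> t x y z u \<in> \<X>"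
    and "p \<in> \<X>" "x \<in> \<X>" "y \<in> \<X>" "z \<in> \<X>" "u \<in> \<X>"
  shows "cov_deriv nab \<theta> [p, x, y, z, u] = nabla4 t p x y z u"
  using assms by (simp add: cov_deriv.simps nab_eq_N nabla4_def lessThan_Suc algebra_simps)

lemma cov_deriv_5:
  assumes "\<And>x y z u v. x \<in> \<X> \<Longrightarrow> y \<in> \<X> \<Longrightarrow> z \<in> \<X> \<Longrightarrow> u \<in> \<X> \<Longrightarrow> v \<in> \<X> \<Longrightarrow>
      \<theta> [x, y, z, u, v] = t x y z u v \<and> t x y z u v \<in> \<X>"
    and "p \<in> \<X>" "x \<in> \<X>" "y \<in> \<X>" "z \<in> \<X>" "u \<in> \<X>" "v \<in> \<X>"
  shows "cov_deriv nab \<theta> [p, x, y, z, u, v] = nabla5 t p x y z u v"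
  using assms by (simp add: cov_deriv.simps nab_eq_N nabla5_def lessThan_Suc algebra_simps)


lemma cov_deriv_curvature:
  assumes "p \<in> \<X>" "x \<in> \<X>" "y \<in> \<X>" "z \<in> \<X>"
  shows "cov_deriv nab (curvature nab) [p, x, y, z] = DR p x y z"
  unfolding DR_def by (rule cov_deriv_3) (use assms in \<open>simp_all add: curvature_eq\<close>)

lemma nabla5_scale:
  "nabla5 (\<lambda>a b x y z. cscale c (t a b x y z)) p a b x y z = cscale c (nabla5 t p a b x y z)"
  by (simp add: nabla5_def N_scale scale_simps)

text \<open>Leibniz rule: in both products of \<open>JJ\<close> either the outer or the inner
  \<open>J\<close> is differentiated.\<close>

lemma nabla5_JJ: "nabla5 JJ p a b x y z = DJJ p a b x y z"
  by (simp add: nabla5_def JJ_def DJJ_def J_def DJ_def sym2_def DR_def nabla3_def N_linear R_linear algebra_simps)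

lemma d1_DR:
  assumes "a \<in> \<X>" "b \<in> \<X>" "x \<in> \<X>" "y \<in> \<X>" "z \<in> \<X>"
  shows "d1 nab (swap12 (cov_deriv nab (curvature nab))) [a, b, x, y, z] = dDR a b x y z"
proof -
  have "cov_deriv nab (swap12 (cov_deriv nab (curvature nab))) [a, b, x, y, z]
    = nabla4 (\<lambda>x y z u. DR y x z u) a b x y z" if "a \<in> \<X>" "b \<in> \<X>" for a b
    by (rule cov_deriv_4) (use that assms in \<open>simp_all add: cov_deriv_curvature\<close>)
  \<comment> \<open>Swapping entries commutes with differentiation, so \<open>x\<close>, the second
    entry of the swapped tensor, becomes the inner derivative direction.\<close>
  moreover have "nabla4 (\<lambda>x y z u. DR y x z u) a b x y z = DDR a x b y z" for a b
    by (simp add: DDR_def nabla4_def algebra_simps)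
  ultimately show ?thesis
    using assms by (simp add: d1.simps dDR_def)
qed

lemma d1_d1_DR:
  assumes "a \<in> \<X>" "b \<in> \<X>" "x \<in> \<X>" "y \<in> \<X>" "z \<in> \<X>" "u \<in> \<X>"
  shows "d1 nab (tscale c (d1 nab (swap12 (cov_deriv nab (curvature nab))))) [a, b, x, y, z, u]
    = cscale c (ddDR a b x y z u)"
proof -
  have "cov_deriv nab (tscale c (d1 nab (swap12 (cov_deriv nab (curvature nab))))) [a, b, x, y, z, u]
    = nabla5 (\<lambda>a b x y z. cscale c (dDR a b x y z)) a b x y z u" if "a \<in> \<X>" "b \<in> \<X>" for a b
    by (rule cov_deriv_5) (use that assms in \<open>simp_all add: tscale_eq d1_DR\<close>)
  then show ?thesis
    using assms
    by (simp add: d1.simps nabla5_scale flip: vfield.scale_right_diff_distrib)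
      (simp add: ddDR_def dDR_def DDDR_def nabla5_def N_linear algebra_simps)
qed

section \<open>The tensors of index two to five with their coefficients\<close>

lemma Theta_2: "Theta nab 2 = tscale 2 (curvature nab)"
  by (simp add: Theta.simps)

text \<open>The factor is \<open>2 * \<i> / (3! * 2!)\<close>.\<close>

lemma S_2:
  assumes "a \<in> \<X>" "x \<in> \<X>" "y \<in> \<X>"
  shows "S_of 2 (Theta nab 2) [a, x, y] = cscale (\<i> / 6) (J a x y)"
  unfolding S_of_def Theta_2 tscale_eq Sym_2_3
  using assms by (simp add: sym2_def J_def tscale_eq curvature_eq scale_simps fact_numeral)

lemma Theta_3: "Theta nab 3 = tscale (- 2 * \<i>) (swap12 (cov_deriv nab (curvature nab)))"
  by (simp add: Theta.simps id1_pow_simps)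

text \<open>The factor is \<open>- 2 * \<i> * \<i> / (4! * 3!)\<close>.\<close>

lemma S_3:
  assumes "a \<in> \<X>" "x \<in> \<X>" "y \<in> \<X>" "z \<in> \<X>"
  shows "S_of 3 (Theta nab 3) [a, x, y, z] = cscale (1 / 72) (K a x y z)"
  unfolding S_of_def Theta_3 tscale_eq Sym_2_4
  using assms
  by (simp add: sym3_def sym2_def K_def tscale_eq cov_deriv_curvature
    scale_simps fact_numeral)

text \<open>The factor is \<open>2 * (\<i> / 6) ^ 2\<close>, where \<open>J_scale\<close> moves the
  inner \<open>\<i> / 6\<close> out.\<close>

lemma wedge_2_2:
  assumes "a \<in> \<X>" "b \<in> \<X>" "x \<in> \<X>" "y \<in> \<X>" "z \<in> \<X>"
  shows "wedge1 2 (tscale 2 (S_of 2 (Theta nab 2))) (S_of 2 (Theta nab 2)) [a, b, x, y, z]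
    = cscale (- 1 / 18) (JJ a b x y z)"
  using assms by (simp add: wedge1.simps tscale_eq S_2 J_scale JJ_def scale_simps)

lemma wedge_2_3:
  assumes "a \<in> \<X>" "b \<in> \<X>" "x \<in> \<X>" "y \<in> \<X>" "z \<in> \<X>" "u \<in> \<X>"
  shows "wedge1 3 (tscale 2 (S_of 2 (Theta nab 2))) (S_of 3 (Theta nab 3)) [a, b, x, y, z, u]
    = cscale (\<i> / 216) (JK a b x y z u)"
  using assms by (simp add: wedge1.simps tscale_eq S_2 S_3 J_scale JK_def scale_simps)

lemma wedge_3_2:
  assumes "a \<in> \<X>" "b \<in> \<X>" "x \<in> \<X>" "y \<in> \<X>" "z \<in> \<X>" "u \<in> \<X>"
  shows "wedge1 2 (tscale 3 (S_of 3 (Theta nab 3))) (S_of 2 (Theta nab 2)) [a, b, x, y, z, u]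
    = cscale (\<i> / 144) (KJ a b x y z u)"
  using assms by (simp add: wedge1.simps tscale_eq S_2 S_3 K_scale KJ_def scale_simps)

lemma d1_wedge_2_2:
  assumes "a \<in> \<X>" "b \<in> \<X>" "x \<in> \<X>" "y \<in> \<X>" "z \<in> \<X>" "u \<in> \<X>"
  shows "d1 nab (wedge1 2 (tscale 2 (S_of 2 (Theta nab 2))) (S_of 2 (Theta nab 2))) [a, b, x, y, z, u]
    = cscale (- 1 / 18) (dJJ a b x y z u)"
proof -
  define c :: complex where "c = - 1 / 18"
  have "cov_deriv nab (wedge1 2 (tscale 2 (S_of 2 (Theta nab 2))) (S_of 2 (Theta nab 2))) [a, b, x, y, z, u]
    = nabla5 (\<lambda>a b x y z. cscale c (JJ a b x y z)) a b x y z u" if "a \<in> \<X>" "b \<in> \<X>" for a b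
    by (rule cov_deriv_5) (use that assms wedge_2_2[folded c_def] in simp_all)
  then show ?thesis
    unfolding c_def[symmetric]
    using assms by (simp add: d1.simps nabla5_scale nabla5_JJ dJJ_def scale_simps)
qed

text \<open>The double sum has the single term \<open>r = 3\<close>, \<open>p = 2\<close>. The
  coefficients are \<open>- 2 * \<i> * \<i> = 2\<close> and
  \<open>24 * (- 1 / 18) = - 4 / 3\<close>.\<close>

lemma Theta_4:
  assumes "a \<in> \<X>" "b \<in> \<X>" "x \<in> \<X>" "y \<in> \<X>" "z \<in> \<X>"
  shows "Theta nab 4 [a, b, x, y, z] p f = 2 / 3 * T4 (\<lambda>X. X p f) a b x y z"
proof -
  have "Theta nab 4 = tscale (- 2 * \<i>) (tscale \<i> (d1 nab (swap12 (cov_deriv nab (curvature nab)))))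
    + tscale 24 (wedge1 2 (tscale 2 (S_of 2 (Theta nab 2))) (S_of 2 (Theta nab 2)))"
    by (subst Theta.simps) (simp add: id1_pow_simps fact_numeral flip: numeral_2_eq_2)
  then have "Theta nab 4 [a, b, x, y, z] = cscale 2 (dDR a b x y z) + cscale (- 4 / 3) (JJ a b x y z)"
    using assms by (simp add: tscale_eq d1_DR wedge_2_2 scale_simps mult.assoc)
  then show ?thesis
    by (simp add: T4_def cscale_def algebra_simps)
qed

text \<open>Here \<open>r = 3\<close> contributes one differentiated product with
  \<open>p = 2\<close>, and \<open>r = 4\<close> two undifferentiated ones with \<open>p = 2\<close>
  and \<open>p = 3\<close>; their factors are \<open>4! = 24\<close> and
  \<open>5! = 120\<close>.\<close>

lemma Theta_5:
  assumes "a \<in> \<X>" "b \<in> \<X>" "x \<in> \<X>" "y \<in> \<X>" "z \<in> \<X>" "u \<in> \<X>"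
  shows "Theta nab 5 [a, b, x, y, z, u] p f = \<i> / 18 * T5 (\<lambda>X. X p f) a b x y z u"
proof -
  have "{2..3} = {2, 3 :: nat}" "{3..4} = {3, 4 :: nat}" by auto
  then have "Theta nab 5
    = tscale (- 2 * \<i>) (tscale \<i> (d1 nab (tscale \<i> (d1 nab (swap12 (cov_deriv nab (curvature nab)))))))
    + (tscale 24 (tscale \<i> (d1 nab (wedge1 2 (tscale 2 (S_of 2 (Theta nab 2))) (S_of 2 (Theta nab 2)))))
      + tscale 120 (wedge1 3 (tscale 2 (S_of 2 (Theta nab 2))) (S_of 3 (Theta nab 3))
        + wedge1 2 (tscale 3 (S_of 3 (Theta nab 3))) (S_of 2 (Theta nab 2))))"
    by (subst Theta.simps) (simp add: id1_pow_simps fact_numeral flip: numeral_2_eq_2)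
  then have "Theta nab 5 [a, b, x, y, z, u] = cscale (2 * \<i>) (ddDR a b x y z u)
      + cscale (- 4 * \<i> / 3) (dJJ a b x y z u)
      + cscale (5 * \<i> / 9) (JK a b x y z u) + cscale (5 * \<i> / 6) (KJ a b x y z u)"
    using assms
    by (simp add: tscale_eq d1_d1_DR d1_wedge_2_2 wedge_2_3 wedge_3_2 scale_simps mult.assoc)
  then show ?thesis
    by (simp add: T5_def cscale_def algebra_simps)
qed

section \<open>Passage to components and conclusion\<close>

lemma additive_eval: "Modules.additive (\<lambda>X :: 'a vfield. X p f)"
  by (simp add: Modules.additive_def)

lemma circ_sym_Theta_4:
  assumes "a \<in> \<X>" "b \<in> \<X>" "c \<in> \<X>" "x \<in> \<X>" "y \<in> \<X>"
  shows "Circ (Sym {3..4 + 1} (Theta nab 4)) [a, b, c, x, y] = 0"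
proof (intro ext)
  fix p f
  \<comment> \<open>Fields are compared at every point \<open>p\<close> and function
    \<open>f\<close>; this evaluation is additive and serves as \<open>ev\<close>.\<close>
  have "Circ (Sym {3..4 + 1} (Theta nab 4)) [a, b, c, x, y] p f
    = 2 / 3 * (sym3 (T4 (\<lambda>X. X p f) a b) c x y + sym3 (T4 (\<lambda>X. X p f) b c) a x y
      + sym3 (T4 (\<lambda>X. X p f) c a) b x y)"
    unfolding Circ.simps Sym_3_5
    using assms by (simp add: sym3_def sym2_def Theta_4 algebra_simps)
  then show "Circ (Sym {3..4 + 1} (Theta nab 4)) [a, b, c, x, y] p f = 0 p f"
    by (simp add: circ_sym_T4[OF additive_eval additive_eval additive_eval additive_eval])
qed

lemma circ_sym_Theta_5:
  assumes "a \<in> \<X>" "b \<in> \<X>" "c \<in> \<X>" "x \<in> \<X>" "y \<in> \<X>" "z \<in> \<X>"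
  shows "Circ (Sym {3..5 + 1} (Theta nab 5)) [a, b, c, x, y, z] = 0"
proof (intro ext)
  fix p f
  have "Circ (Sym {3..5 + 1} (Theta nab 5)) [a, b, c, x, y, z] p f
    = \<i> / 18 * (sym4 (T5 (\<lambda>X. X p f) a b) c x y z + sym4 (T5 (\<lambda>X. X p f) b c) a x y z
      + sym4 (T5 (\<lambda>X. X p f) c a) b x y z)"
    unfolding Circ.simps Sym_3_6
    using assms by (simp add: sym4_def sym3_def sym2_def Theta_5 algebra_simps)
  then show "Circ (Sym {3..5 + 1} (Theta nab 5)) [a, b, c, x, y, z] p f = 0 p f"
    by (simp add: circ_sym_T5[OF additive_eval additive_eval additive_eval additive_eval additive_eval])
qed

end

theorem mainTheorem3:
  fixes n :: nat and M :: "'a topology" and \<A> :: "'a atlas"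
    and nab :: "'a vfield \<Rightarrow> 'a vfield \<Rightarrow> 'a vfield"
  assumes "smooth_manifold n M \<A>"
    and "complex_connection n M \<A> nab"
    and "torsion_free n M \<A> nab"
  shows "\<forall>k\<in>{4, 5}. \<forall>vs. length vs = k + 1 \<and> set vs \<subseteq> cvector_fields n M \<A> \<longrightarrow>
    Circ (Sym {3..k + 1} (Theta nab k)) vs = 0"
proof -
  interpret torsion_free_connection n M \<A> nab
    using assms by unfold_locales
  have "Circ (Sym {3..4 + 1} (Theta nab 4)) vs = 0" if "length vs = 4 + 1" "set vs \<subseteq> \<X>" for vs
    using that circ_sym_Theta_4 by (auto simp: length_Suc_conv numeral_eq_Suc)
  moreover have "Circ (Sym {3..5 + 1} (Theta nab 5)) vs = 0" if "length vs = 5 + 1" "set vs \<subseteq> \<X>" for vs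
    using that circ_sym_Theta_5 by (auto simp: length_Suc_conv numeral_eq_Suc)
  ultimately show ?thesis by blast
qed

end
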